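(* Let $q=p^m$ with $p$ prime and $m\ge 1$, and let $C=(n,p^\kappa)_q$ be an additive code over $\mathbb{F}_q\times\mathbb{F}_q$ of length $n$. Assume that the puncture code $P(C)$ contains a codeword of Hamming weight $r$. Then one can derive from $C$ an additive code $C'=(r,p^{\kappa'})_q$ over $\mathbb{F}_q\times\mathbb{F}_q$ of length $r$ with $\kappa'\le\kappa$ that is self-orthogonal with respect to the symplectic form (i.e. such a code $C'$ exists), such that the minimum distance of $(C')^*$ is not smaller than the minimum distance of $C^*$.
   Context: Let $\mathrm{tr}$ denote the absolute trace $\mathbb{F}_q\to\mathbb{F}_p$. An additive code $C=(n,p^\kappa)_q$ is an additive subgroup (equivalently, $\mathbb{F}_p$-subspace) of $(\mathbb{F}_q\times\mathbb{F}_q)^n$ with $p^\kappa$ elements; its elements are written $(\boldsymbol{a}|\boldsymbol{b})=(a_1,\dots,a_n|b_1,\dots,b_n)$ with $i$-th coordinate the pair $(a_i,b_i)$. The weight of $(\boldsymbol{a}|\boldsymbol{b})$ is the number of indices $i$ with $(a_i,b_i)\neq(0,0)$, and the minimum distance of an additive code is the minimum weight of its non-zero elements (taken to be $+\infty$ for the zero code). The symplectic form is the $\mathbb{F}_p$-valued form $(\boldsymbol{a}|\boldsymbol{b})*(\boldsymbol{a}'|\boldsymbol{b}')=\mathrm{tr}\left(\sum_{i=1}^n(a_i'b_i-a_ib_i')\right)$. The symplectic dual of $C$ is $C^*=\{v\in(\mathbb{F}_q\times\mathbb{F}_q)^n : v*w=0 \text{ for all } w\in C\}$, and $C$ is self-orthogonal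 if $C\subseteq C^*$. The same definitions apply for length $r$. The (Rains) puncture code of $C$ is the $\mathbb{F}_p$-linear code $$P(C)=\Big\langle\big(\mathrm{tr}(a_1b_1'-a_1'b_1),\dots,\mathrm{tr}(a_nb_n'-a_n'b_n)\big) : (\boldsymbol{a}|\boldsymbol{b}),(\boldsymbol{a}'|\boldsymbol{b}')\in C\Big\rangle^{\perp}\subseteq\mathbb{F}_p^n,$$ where $\langle\cdot\rangle$ is the $\mathbb{F}_p$-span and $\perp$ is the dual with respect to the standard Euclidean bilinear form on $\mathbb{F}_p^n$. The Hamming weight of a vector in $\mathbb{F}_p^n$ is its number of non-zero coordinates. *)

theory Defs
  imports
    "Jordan_Normal_Form.Matrix"
    "HOL-Library.Product_Plus"
    "HOL-Library.Extended_Nat"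
    "HOL-Library.Cardinality"
    "HOL-Computational_Algebra.Primes"
begin

text \<open>
  The field with \<open>q = p ^ m\<close> elements is a type \<open>'a :: {field, finite}\<close> with
  \<open>CARD('a) = p ^ m\<close>, and the field with \<open>p\<close> elements is its prime subfield
  \<open>\<int> = range of_int\<close> (as a subset of \<open>'a\<close>).
  The space of pairs of field elements of length \<open>n\<close> is
  \<open>carrier_vec n :: ('a \<times> 'a) vec set\<close>; its element \<open>(a|b)\<close> is the vector whose
  \<open>i\<close>-th entry is the pair \<open>(a_i, b_i)\<close>, with indices starting from 0.
\<close>

text \<open>The absolute trace as the sum of the Frobenius conjugates; its values lie in \<open>\<int>\<close>.\<close>

definition abs_trace :: "nat \<Rightarrow> nat \<Rightarrow> 'a :: field \<Rightarrow> 'a" where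
  "abs_trace p m x = (\<Sum>i<m. x ^ (p ^ i))"

definition additive_code :: "nat \<Rightarrow> nat \<Rightarrow> nat \<Rightarrow> ('a \<times> 'a :: field) vec set \<Rightarrow> bool" where
  "additive_code p n \<kappa> C \<longleftrightarrow>
     subgroup C (monoid_vec TYPE('a \<times> 'a) n) \<and> card C = p ^ \<kappa>"

text \<open>On vectors of pairs, \<open>0\<close> below is \<open>(0, 0)\<close>.\<close>

definition hamming_weight :: "'b :: zero vec \<Rightarrow> nat" where
  "hamming_weight v = card {i. i < dim_vec v \<and> v $ i \<noteq> 0}"

text \<open>The infimum over the empty set in \<^typ>\<open>enat\<close> is \<open>\<infinity>\<close>, the value for the zero code.\<close>

definition min_dist :: "nat \<Rightarrow> 'b :: zero vec set \<Rightarrow> enat" where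
  "min_dist n C = (INF v \<in> C - {0\<^sub>v n}. enat (hamming_weight v))"

definition symplectic_form ::
    "nat \<Rightarrow> nat \<Rightarrow> nat \<Rightarrow> ('a \<times> 'a :: field) vec \<Rightarrow> ('a \<times> 'a) vec \<Rightarrow> 'a" where
  "symplectic_form p m n v w =
     abs_trace p m (\<Sum>i<n. fst (w $ i) * snd (v $ i) - fst (v $ i) * snd (w $ i))"

definition symplectic_dual ::
    "nat \<Rightarrow> nat \<Rightarrow> nat \<Rightarrow> ('a \<times> 'a :: field) vec set \<Rightarrow> ('a \<times> 'a) vec set" where
  "symplectic_dual p m n C =
     {v \<in> carrier_vec n. \<forall>w \<in> C. symplectic_form p m n v w = 0}"

definition self_orthogonal ::
    "nat \<Rightarrow> nat \<Rightarrow> nat \<Rightarrow> ('a \<times> 'a :: field) vec set \<Rightarrow> bool" where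
  "self_orthogonal p m n C \<longleftrightarrow> C \<subseteq> symplectic_dual p m n C"

definition prime_vecs :: "nat \<Rightarrow> 'a :: field vec set" where
  "prime_vecs n = {x \<in> carrier_vec n. \<forall>i<n. x $ i \<in> \<int>}"

text \<open>Linear combinations with coefficients in the prime subfield.\<close>

definition prime_span :: "nat \<Rightarrow> 'a :: field vec set \<Rightarrow> 'a vec set" where
  "prime_span n S =
     {vec n (\<lambda>i. \<Sum>v\<in>A. c v * v $ i) | A c. finite A \<and> A \<subseteq> S \<and> (\<forall>v\<in>A. c v \<in> \<int>)}"

definition euclidean_dual :: "nat \<Rightarrow> 'a :: field vec set \<Rightarrow> 'a vec set" where
  "euclidean_dual n D = {x \<in> prime_vecs n. \<forall>y \<in> D. x \<bullet> y = 0}"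

definition puncture_code ::
    "nat \<Rightarrow> nat \<Rightarrow> nat \<Rightarrow> ('a \<times> 'a :: field) vec set \<Rightarrow> 'a vec set" where
  "puncture_code p m n C =
     euclidean_dual n (prime_span n
       {vec n (\<lambda>i. abs_trace p m (fst (v $ i) * snd (w $ i) - fst (w $ i) * snd (v $ i)))
         | v w. v \<in> C \<and> w \<in> C})"

end

theory Submission
  imports Defs "HOL-Algebra.Coset" "HOL-Number_Theory.Residues"
begin

text \<open>
  Let \<open>c\<close> be a codeword of \<open>P(C)\<close> with support \<open>I\<close> of size \<open>r\<close>. Send \<open>(a|b)\<close> to
  \<open>(a_i | c_i b_i)\<close> with \<open>i\<close> restricted to \<open>I\<close>, and let \<open>C'\<close> be the image of \<open>C\<close>.
  Since \<open>c_i\<close> lies in the prime field, the symplectic form of two images is the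
  Euclidean product of \<open>c\<close> with a generator of the span defining \<open>P(C)\<close>, hence zero.
  If \<open>(u|v)\<close> is in the dual of \<open>C'\<close>, then \<open>(c u|v)\<close>, extended by zero outside \<open>I\<close>,
  is in the dual of \<open>C\<close> and has the same weight as \<open>(u|v)\<close>.
\<close>

text \<open>First isomorphism theorem and Lagrange: the image has as many elements as the kernel has
  cosets. Applied to the code, this makes the size of its image a power of \<open>p\<close>.\<close>

lemma (in group_hom) card_image_dvd_order:
  "card (h ` carrier G) dvd order G"
proof -
  let ?K = "kernel G H h"
  \<comment> \<open>Cutting the codomain down to the image makes \<open>h\<close> surjective and
    leaves the kernel unchanged.\<close>
  interpret im: group_hom G "H\<lparr>carrier := h ` carrier G\<rparr>" h
  proof (intro group_hom.intro group_hom_axioms.intro)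
    show "group (H\<lparr>carrier := h ` carrier G\<rparr>)"
      by (rule subgroup.subgroup_is_group[OF img_is_subgroup H.group_axioms])
    show "h \<in> hom G (H\<lparr>carrier := h ` carrier G\<rparr>)"
      by (rule homI) simp_all
  qed (rule G.group_axioms)
  have K: "kernel G (H\<lparr>carrier := h ` carrier G\<rparr>) h = ?K"
    by (simp add: kernel_def)
  have "bij_betw (\<lambda>X. the_elem (h ` X)) (carrier (G Mod ?K)) (h ` carrier G)"
    using im.FactGroup_iso_set unfolding K by (simp add: iso_def)
  hence "card (h ` carrier G) = card (rcosets ?K)"
    by (simp add: bij_betw_same_card FactGroup_def)
  thus ?thesis
    using G.lagrange[OF subgroup_kernel] by (metis dvd_triv_left)
qed

lemma CHAR_eq_if_CARD_eq_prime_power: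
  assumes "prime p" and "CARD('a :: {field, finite}) = p ^ m"
  shows "CHAR('a) = p"
proof -
  have "prime CHAR('a)"
    by (intro prime_CHAR_semidom finite_imp_CHAR_pos) simp
  moreover have "CHAR('a) dvd p ^ m"
    using CHAR_dvd_CARD[where 'a = 'a] assms by simp
  ultimately show ?thesis
    using assms(1) primes_dvd_imp_eq prime_dvd_power by blast
qed

text \<open>Fermat's little theorem, by induction with the freshman's dream.\<close>

lemma of_nat_power_CHAR:
  assumes "prime CHAR('a :: comm_semiring_1)"
  shows "(of_nat k :: 'a) ^ CHAR('a) = of_nat k"
proof (induction k)
  case 0
  show ?case using assms by (simp add: power_0_left prime_gt_0_nat)
next
  case (Suc k)
  thus ?case by (simp add: freshmans_dream[OF assms refl])
qed

lemma Ints_power_CHAR_power: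
  fixes c :: "'a :: comm_ring_1"
  assumes "prime CHAR('a)" and "c \<in> \<int>"
  shows "c ^ (CHAR('a) ^ i) = c"
proof -
  have "c ^ CHAR('a) = c"
  proof -
    from assms(2) obtain k where "c = of_int k" by (auto elim: Ints_cases)
    show ?thesis
    proof (cases "k \<ge> 0")
      case True
      thus ?thesis using of_nat_power_CHAR[OF assms(1), of "nat k"] \<open>c = of_int k\<close> by simp
    next
      case False
      \<comment> \<open>Raising to a prime characteristic commutes with negation, also in
        characteristic 2.\<close>
      hence "c = - of_nat (nat (- k))" using \<open>c = of_int k\<close> by simp
      thus ?thesis using of_nat_power_CHAR[OF assms(1), of "nat (- k)"]
        by (simp add: minus_power_prime_CHAR[OF refl assms(1)])
    qed
  qed
  thus ?thesis by (induction i) (simp_all add: power_mult)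
qed

lemma abs_trace_sum:
  fixes f :: "'b \<Rightarrow> 'a :: field"
  assumes "prime CHAR('a)"
  shows "abs_trace CHAR('a) m (sum f A) = (\<Sum>j\<in>A. abs_trace CHAR('a) m (f j))"
  unfolding abs_trace_def freshmans_dream_sum'[OF assms refl] by (rule sum.swap)

text \<open>The Frobenius map fixes the prime field, so \<open>c\<close> factors out of every
  conjugate of \<open>c * x\<close>.\<close>

lemma abs_trace_mult_Ints:
  fixes c x :: "'a :: field"
  assumes "prime CHAR('a)" and "c \<in> \<int>"
  shows "abs_trace CHAR('a) m (c * x) = c * abs_trace CHAR('a) m x"
  by (simp add: abs_trace_def power_mult_distrib Ints_power_CHAR_power[OF assms] sum_distrib_left)

text \<open>A generator is the linear combination of itself alone with coefficient 1, so it lies in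
  the span to which \<open>c\<close> is orthogonal.\<close>

lemma puncture_code_orthogonal:
  fixes C :: "('a \<times> 'a :: field) vec set"
  assumes "c \<in> puncture_code p m n C" and "v \<in> C" and "w \<in> C"
  shows "(\<Sum>i<n. c $ i * abs_trace p m (fst (v $ i) * snd (w $ i) - fst (w $ i) * snd (v $ i))) = 0"
proof -
  define y where
    "y = vec n (\<lambda>i. abs_trace p m (fst (v $ i) * snd (w $ i) - fst (w $ i) * snd (v $ i)))"
  let ?S = "{vec n (\<lambda>i. abs_trace p m (fst (v $ i) * snd (w $ i) - fst (w $ i) * snd (v $ i)))
         | v w. v \<in> C \<and> w \<in> C}"
  have "y \<in> ?S" using assms(2,3) unfolding y_def by (intro CollectI exI[of _ v] exI[of _ w] conjI refl)
  moreover have "y = vec n (\<lambda>i. \<Sum>v\<in>{y}. 1 * v $ i)" by (auto simp: y_def)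
  ultimately have "y \<in> prime_span n ?S"
    unfolding prime_span_def by (intro CollectI exI[of _ "{y}"] exI[of _ "\<lambda>_. 1"]) auto
  with assms(1) have "c \<bullet> y = 0" by (simp add: puncture_code_def euclidean_dual_def)
  thus ?thesis by (simp add: scalar_prod_def y_def atLeast0LessThan)
qed

text \<open>Here \<open>g\<close> is meant to enumerate the support of \<open>c\<close>. Only the
  second component is scaled, so each term of the symplectic form picks up \<open>c\<close> exactly
  once.\<close>

definition puncture_vec ::
    "(nat \<Rightarrow> nat) \<Rightarrow> nat \<Rightarrow> 'a vec \<Rightarrow> ('a \<times> 'a :: field) vec \<Rightarrow> ('a \<times> 'a) vec" where
  "puncture_vec g r c v = vec r (\<lambda>j. (fst (v $ g j), c $ g j * snd (v $ g j)))"

text \<open>The adjoint of \<open>puncture_vec\<close> for the symplectic forms; the factor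
  \<open>c\<close> therefore moves to the first component.\<close>

definition lift_vec ::
    "(nat \<Rightarrow> nat) \<Rightarrow> nat \<Rightarrow> nat \<Rightarrow> 'a vec \<Rightarrow> ('a \<times> 'a :: field) vec \<Rightarrow> ('a \<times> 'a) vec" where
  "lift_vec g r n c v = vec n (\<lambda>i. if i \<in> g ` {..<r}
     then (c $ i * fst (v $ inv_into {..<r} g i), snd (v $ inv_into {..<r} g i)) else 0)"

lemma group_hom_puncture_vec:
  fixes C :: "('a \<times> 'a :: field) vec set"
  assumes "subgroup C (monoid_vec TYPE('a \<times> 'a) n)" and "g ` {..<r} \<subseteq> {..<n}"
  shows "group_hom ((monoid_vec TYPE('a \<times> 'a) n)\<lparr>carrier := C\<rparr>) (monoid_vec TYPE('a \<times> 'a) r)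
     (puncture_vec g r c)"
proof -
  interpret A: comm_group "monoid_vec TYPE('a \<times> 'a) n" by (rule comm_group_vec)
  interpret B: comm_group "monoid_vec TYPE('a \<times> 'a) r" by (rule comm_group_vec)
  interpret S: group "(monoid_vec TYPE('a \<times> 'a) n)\<lparr>carrier := C\<rparr>"
    using subgroup.subgroup_is_group[OF assms(1) A.group_axioms] .
  have sub: "C \<subseteq> carrier_vec n"
    using subgroup.subset[OF assms(1)] by (simp add: monoid_vec_simps)
  have "puncture_vec g r c (v + w) = puncture_vec g r c v + puncture_vec g r c w"
    if "v \<in> C" and "w \<in> C" for v w
  proof (rule eq_vecI)
    fix j assume "j < dim_vec (puncture_vec g r c v + puncture_vec g r c w)"
    hence j: "j < r" by (simp add: puncture_vec_def)
    hence "g j < n" using assms(2) by auto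
    moreover have "dim_vec w = n" using that sub by auto
    ultimately show "puncture_vec g r c (v + w) $ j = (puncture_vec g r c v + puncture_vec g r c w) $ j"
      using j by (simp add: puncture_vec_def algebra_simps)
  qed (simp add: puncture_vec_def)
  hence "puncture_vec g r c \<in> hom ((monoid_vec TYPE('a \<times> 'a) n)\<lparr>carrier := C\<rparr>) (monoid_vec TYPE('a \<times> 'a) r)"
    by (auto simp: hom_def monoid_vec_simps puncture_vec_def)
  thus ?thesis by unfold_locales
qed

text \<open>The factor \<open>c $ i\<close> vanishes off the support, so the sum extends to all
  coordinates; linearity of the trace over the prime field then pulls the factor out.\<close>

lemma symplectic_form_puncture_vec:
  fixes v w :: "('a \<times> 'a :: field) vec"
  assumes "prime CHAR('a)" and "c \<in> prime_vecs n"
    and "bij_betw g {..<r} {i. i < n \<and> c $ i \<noteq> 0}"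
  shows "symplectic_form CHAR('a) m r (puncture_vec g r c v) (puncture_vec g r c w) =
    (\<Sum>i<n. c $ i * abs_trace CHAR('a) m (fst (w $ i) * snd (v $ i) - fst (v $ i) * snd (w $ i)))"
proof -
  let ?f = "\<lambda>i. c $ i * (fst (w $ i) * snd (v $ i) - fst (v $ i) * snd (w $ i))"
  have "symplectic_form CHAR('a) m r (puncture_vec g r c v) (puncture_vec g r c w) =
      abs_trace CHAR('a) m (\<Sum>j<r. ?f (g j))"
    by (simp add: symplectic_form_def puncture_vec_def algebra_simps)
  also have "(\<Sum>j<r. ?f (g j)) = (\<Sum>i\<in>{i. i < n \<and> c $ i \<noteq> 0}. ?f i)"
    by (rule sum.reindex_bij_betw[OF assms(3)])
  also have "\<dots> = (\<Sum>i<n. ?f i)"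
    by (rule sum.mono_neutral_left) auto
  also have "abs_trace CHAR('a) m \<dots> = (\<Sum>i<n. abs_trace CHAR('a) m (?f i))"
    by (rule abs_trace_sum[OF assms(1)])
  also have "\<dots> = (\<Sum>i<n. c $ i *
      abs_trace CHAR('a) m (fst (w $ i) * snd (v $ i) - fst (v $ i) * snd (w $ i)))"
    using assms(2) by (intro sum.cong refl abs_trace_mult_Ints[OF assms(1)]) (auto simp: prime_vecs_def)
  finally show ?thesis .
qed

text \<open>Adjointness: off the support the lift is zero, and on it both sides have the same
  summands under the trace.\<close>

lemma symplectic_form_lift_vec:
  fixes v w :: "('a \<times> 'a :: field) vec"
  assumes "bij_betw g {..<r} {i. i < n \<and> c $ i \<noteq> 0}"
  shows "symplectic_form p m n (lift_vec g r n c v) w =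
    symplectic_form p m r v (puncture_vec g r c w)"
proof -
  let ?I = "{i. i < n \<and> c $ i \<noteq> 0}"
  let ?f = "\<lambda>i. fst (w $ i) * snd (lift_vec g r n c v $ i) - fst (lift_vec g r n c v $ i) * snd (w $ i)"
  have inj: "inj_on g {..<r}" and img: "g ` {..<r} = ?I"
    using assms by (auto simp: bij_betw_def)
  have "(\<Sum>i<n. ?f i) = (\<Sum>i\<in>?I. ?f i)"
    by (rule sum.mono_neutral_right) (auto simp: lift_vec_def img)
  also have "\<dots> = (\<Sum>j<r. ?f (g j))"
    by (rule sum.reindex_bij_betw[OF assms, symmetric])
  also have "\<dots> = (\<Sum>j<r. fst (puncture_vec g r c w $ j) * snd (v $ j)
      - fst (v $ j) * snd (puncture_vec g r c w $ j))"
  proof (rule sum.cong)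
    fix j assume "j \<in> {..<r}"
    moreover from this have "g j \<in> ?I" using img by blast
    ultimately show "?f (g j) = fst (puncture_vec g r c w $ j) * snd (v $ j)
      - fst (v $ j) * snd (puncture_vec g r c w $ j)"
      using inj by (simp add: lift_vec_def puncture_vec_def)
  qed simp
  finally show ?thesis by (simp add: symplectic_form_def)
qed

text \<open>On the support, scaling by a non-zero \<open>c $ i\<close> does not change whether a
  pair is zero.\<close>

lemma hamming_weight_lift_vec:
  fixes v :: "('a \<times> 'a :: field) vec"
  assumes "bij_betw g {..<r} {i. i < n \<and> c $ i \<noteq> 0}" and "v \<in> carrier_vec r"
  shows "hamming_weight (lift_vec g r n c v) = hamming_weight v"
proof -
  let ?I = "{i. i < n \<and> c $ i \<noteq> 0}"
  have inj: "inj_on g {..<r}" and img: "g ` {..<r} = ?I"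
    using assms by (auto simp: bij_betw_def)
  have eq: "lift_vec g r n c v $ g j \<noteq> 0 \<longleftrightarrow> v $ j \<noteq> 0" if "j < r" for j
  proof -
    have "g j \<in> ?I" using img that by blast
    thus ?thesis using inj that by (simp add: lift_vec_def prod_eq_iff)
  qed
  have "{i. i < n \<and> lift_vec g r n c v $ i \<noteq> 0} = g ` {j. j < r \<and> v $ j \<noteq> 0}"
  proof (intro equalityI subsetI)
    fix i assume i: "i \<in> {i. i < n \<and> lift_vec g r n c v $ i \<noteq> 0}"
    hence "i \<in> g ` {..<r}" by (auto simp: lift_vec_def split: if_splits)
    thus "i \<in> g ` {j. j < r \<and> v $ j \<noteq> 0}" using i eq by auto
  next
    fix i assume "i \<in> g ` {j. j < r \<and> v $ j \<noteq> 0}"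
    thus "i \<in> {i. i < n \<and> lift_vec g r n c v $ i \<noteq> 0}" using img eq by auto
  qed
  moreover have "inj_on g {j. j < r \<and> v $ j \<noteq> 0}"
    using inj by (rule inj_on_subset) auto
  moreover have "dim_vec v = r" "dim_vec (lift_vec g r n c v) = n"
    using assms(2) by (auto simp: lift_vec_def)
  ultimately show ?thesis by (simp add: hamming_weight_def card_image)
qed

lemma hamming_weight_eq_0_iff:
  assumes "v \<in> carrier_vec n"
  shows "hamming_weight v = 0 \<longleftrightarrow> v = 0\<^sub>v n"
  using assms by (auto simp: hamming_weight_def)

text \<open>Weight 0 characterises the zero vector, so \<open>f\<close> sends non-zero elements to
  non-zero elements and every weight on the right also occurs on the left. If \<open>D\<close> has
  no non-zero element, the right side is infinite.\<close>

lemma min_dist_mono_weight: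
  fixes f :: "'b :: zero vec \<Rightarrow> 'c :: zero vec"
  assumes "\<And>v. v \<in> D \<Longrightarrow> f v \<in> E" and "\<And>v. v \<in> D \<Longrightarrow> hamming_weight (f v) = hamming_weight v"
    and "D \<subseteq> carrier_vec r" and "E \<subseteq> carrier_vec n"
  shows "min_dist n E \<le> min_dist r D"
  unfolding min_dist_def
proof (rule INF_mono)
  fix v assume v: "v \<in> D - {0\<^sub>v r}"
  hence "hamming_weight (f v) \<noteq> 0"
    using assms hamming_weight_eq_0_iff by (metis DiffD1 DiffD2 singletonI subsetD)
  hence "f v \<in> E - {0\<^sub>v n}"
    using v assms hamming_weight_eq_0_iff by (metis DiffD1 DiffI singletonD subsetD)
  thus "\<exists>u\<in>E - {0\<^sub>v n}. enat (hamming_weight u) \<le> enat (hamming_weight v)"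
    using v assms(2) by (intro bexI[of _ "f v"]) auto
qed

theorem theorem4p6:
  fixes p m n \<kappa> r :: nat
    and C :: "('a \<times> 'a :: {field, finite}) vec set"
  assumes "prime p" and "m \<ge> 1" and "CARD('a) = p ^ m"
    and "additive_code p n \<kappa> C"
    and "\<exists>c \<in> puncture_code p m n C. hamming_weight c = r"
  shows "\<exists>(C' :: ('a \<times> 'a) vec set) \<kappa>'.
           additive_code p r \<kappa>' C' \<and> \<kappa>' \<le> \<kappa> \<and> self_orthogonal p m r C' \<and>
           min_dist r (symplectic_dual p m r C') \<ge> min_dist n (symplectic_dual p m n C)"
proof -
  have p: "p = CHAR('a)"
    using CHAR_eq_if_CARD_eq_prime_power[OF assms(1,3)] by simp
  have prime: "prime CHAR('a)" using assms(1) p by simp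
  obtain c where c: "c \<in> puncture_code p m n C" and wt: "hamming_weight c = r"
    using assms(5) by blast
  have cP: "c \<in> prime_vecs n"
    using c by (simp add: puncture_code_def euclidean_dual_def)
  let ?I = "{i. i < n \<and> c $ i \<noteq> 0}"
  have "card ?I = r"
    using wt cP by (auto simp: hamming_weight_def prime_vecs_def)
  then obtain g where g: "bij_betw g {..<r} ?I"
    using bij_betw_from_nat_into_finite[of ?I] by auto
  define C' where "C' = puncture_vec g r c ` C"
  have sub: "subgroup C (monoid_vec TYPE('a \<times> 'a) n)" and cardC: "card C = p ^ \<kappa>"
    using assms(4) by (auto simp: additive_code_def)
  interpret h: group_hom "(monoid_vec TYPE('a \<times> 'a) n)\<lparr>carrier := C\<rparr>"
    "monoid_vec TYPE('a \<times> 'a) r" "puncture_vec g r c"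
    using g by (intro group_hom_puncture_vec[OF sub]) (auto simp: bij_betw_def)
  have "card C' dvd p ^ \<kappa>"
    using h.card_image_dvd_order cardC by (simp add: C'_def order_def)
  then obtain \<kappa>' where \<kappa>': "\<kappa>' \<le> \<kappa>" "card C' = p ^ \<kappa>'"
    using divides_primepow_nat[OF assms(1)] by blast
  have "additive_code p r \<kappa>' C'"
    using h.img_is_subgroup \<kappa>'(2) by (simp add: additive_code_def C'_def)
  moreover have "self_orthogonal p m r C'"
  proof -
    have "symplectic_form p m r (puncture_vec g r c v) (puncture_vec g r c w) = 0"
      if "v \<in> C" and "w \<in> C" for v w
      \<comment> \<open>The generators of the puncture code carry the opposite sign to the
        symplectic form, hence the swapped pair.\<close>
      using puncture_code_orthogonal[OF c that(2,1)]
        symplectic_form_puncture_vec[OF prime cP g, of m v w] by (simp add: p)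
    thus ?thesis
      by (auto simp: self_orthogonal_def symplectic_dual_def C'_def puncture_vec_def)
  qed
  moreover have "min_dist n (symplectic_dual p m n C) \<le> min_dist r (symplectic_dual p m r C')"
  \<comment> \<open>By adjointness, a lift is orthogonal to \<open>C\<close> because the original
    vector is orthogonal to the image \<open>C'\<close>.\<close>
  proof (rule min_dist_mono_weight[where f = "lift_vec g r n c"])
    fix v assume v: "v \<in> symplectic_dual p m r C'"
    thus "lift_vec g r n c v \<in> symplectic_dual p m n C"
      by (auto simp: symplectic_dual_def symplectic_form_lift_vec[OF g] C'_def) (simp add: lift_vec_def)
    show "hamming_weight (lift_vec g r n c v) = hamming_weight v"
      using v by (intro hamming_weight_lift_vec[OF g]) (simp add: symplectic_dual_def)
  qed (auto simp: symplectic_dual_def)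
  ultimately show ?thesis using \<kappa>'(1) by blast
qed

end
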